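(* There exist universal constants $\mu_0>1$ and $C>0$ such that the following holds for every $\mu\ge\mu_0$. Let $0<c<M$ and let $B:\mathbb{Z}\to\mathrm{M}(2,\mathbb{C})$ satisfy $c<\|B(j)\|<M$ for all $j\in\mathbb{Z}$. Suppose that for each $j\in\mathbb{Z}$, $B(j+1)B(j)\ne0$ and $$\frac{\sigma_2(B(j))}{\sigma_1(B(j))}\le \mu^{-1},\qquad \frac{\sigma_1(B(j+1))\,\sigma_1(B(j))}{\sigma_1(B(j+1)B(j))}\le \mu^{\frac14}.$$ Then $B$ admits dominated splitting, and for each $j\in\mathbb{Z}$ and each $n\ge3$, $$\left|\log\|B_n(j)\|+\sum_{k=1}^{n-2}\log\|B(j+k)\|-\sum_{k=0}^{n-2}\log\|B(j+k+1)B(j+k)\|\right|\le Cn\mu^{-\frac12}.$$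
   Context: $\mathrm{M}(2,\mathbb{C})$ is the space of complex $2\times2$ matrices, $\|\cdot\|$ is the operator norm (for the Euclidean norm on $\mathbb{C}^2$). For $B:\mathbb{Z}\to\mathrm{M}(2,\mathbb{C})$, $B_n(j)=B(j+n-1)\cdots B(j)$ for $n\ge1$ and $B_0(j)=I_2$. For a nonzero $A\in\mathrm{M}(2,\mathbb{C})$, $\sigma_1(A)=\|A\|$ and $\sigma_2(A)=|\det A|/\|A\|$ (the singular values). Distance on lines: for one-dimensional subspaces $V,W$ of $\mathbb{C}^2$ spanned by unit vectors $\vec v,\vec w$, $d(V,W)=2|\det(\vec v,\vec w)|$, where $(\vec v,\vec w)$ is the matrix with columns $\vec v,\vec w$. Dominated splitting: $B$ admits dominated splitting if for each $j\in\mathbb{Z}$ there are one-dimensional subspaces $E^u(j),E^s(j)$ of $\mathbb{C}^2$ such that: (a) $B(j)[E^u(j)]\subseteq E^u(j+1)$ and $B(j)[E^s(j)]\subseteq E^s(j+1)$ for all $j$; (b) there exist $N\in\mathbb{Z}_+$ (positive integer) and $\lambda>1$ such that $\|B_N(j)\vec u(j)\|>\lambda\|B_N(j)\vec s(j)\|$ for all $j\in\mathbb{Z}$ and all unit vectors $\vec u(j)\in E^u(j)$, $\vec s(j)\in E^s(j)$; (c) $\inf_{j\in\mathbb{Z}}d(E^u(j),E^s(j))>0$; (d) for the same $N$ as in (b), $\inf_{j\in\mathbb{Z}}\|B_N(j)\|>0$. *)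

theory Defs
  imports "HOL-Analysis.Analysis"
begin

(* The norm that the library puts on complex^2^2 is the Frobenius norm, and its ring
   multiplication is entrywise; hence the explicit operator norm here and the use of ** below. *)
definition opnorm :: "complex^2^2 \<Rightarrow> real" where
  "opnorm A = onorm ((*v) A)"

definition sigma1 :: "complex^2^2 \<Rightarrow> real" where
  "sigma1 A = opnorm A"

definition sigma2 :: "complex^2^2 \<Rightarrow> real" where
  "sigma2 A = cmod (det A) / opnorm A"

primrec iterate :: "(int \<Rightarrow> complex^2^2) \<Rightarrow> nat \<Rightarrow> int \<Rightarrow> complex^2^2" where
  "iterate B 0 j = mat 1"
| "iterate B (Suc n) j = B (j + int n) ** iterate B n j"

(* vec.subspace and vec.dim are over the scalar field complex, unlike subspace and dim. *)
definition is_line :: "(complex^2) set \<Rightarrow> bool" where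
  "is_line V \<longleftrightarrow> vec.subspace V \<and> vec.dim V = 1"

(* The choice of unit vectors is immaterial, so the description is proper: see line_dist_eq below. *)
definition line_dist :: "(complex^2) set \<Rightarrow> (complex^2) set \<Rightarrow> real" where
  "line_dist V W = (THE d. \<exists>v\<in>V. \<exists>w\<in>W. norm v = 1 \<and> norm w = 1 \<and>
      d = 2 * cmod (det (transpose (vector [v, w]) :: complex^2^2)))"

lemma is_line_unit_multiple:
  assumes V: "is_line V" and v: "v \<in> V" "norm v = 1" and u: "u \<in> V" "norm u = 1"
  obtains a where "u = a *s v" "cmod a = 1"
proof -
  have "v \<noteq> 0" using v by auto
  then have "vec.independent {v}" by simp
  with V v have "V \<subseteq> vec.span {v}"
    unfolding is_line_def by (intro vec.card_ge_dim_independent) auto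
  with u obtain a where a: "u = a *s v"
    by (auto simp: vec.span_singleton)
  have "norm u = cmod a * norm v"
    unfolding a by (simp add: norm_vec_def L2_set_right_distrib norm_mult)
  with u v have "cmod a = 1" by simp
  with a show thesis by (rule that)
qed

lemma is_line_unit_exists:
  assumes "is_line V"
  obtains v where "v \<in> V" "norm v = 1"
proof -
  have "\<not> V \<subseteq> {0}"
  proof
    assume "V \<subseteq> {0}"
    then have "vec.dim V \<le> vec.dim ({0} :: (complex^2) set)" by (rule vec.dim_subset)
    with assms show False by (simp add: is_line_def)
  qed
  then obtain x where x: "x \<in> V" "x \<noteq> 0" by auto
  let ?v = "complex_of_real (inverse (norm x)) *s x"
  have "?v \<in> V" using assms x by (auto simp: is_line_def intro: vec.subspace_scale)
  moreover have "norm ?v = cmod (complex_of_real (inverse (norm x))) * norm x"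
    by (simp only: norm_vec_def L2_set_right_distrib norm_mult vector_smult_component norm_ge_zero)
  then have "norm ?v = 1" using x by (simp add: norm_inverse)
  ultimately show thesis by (rule that)
qed

lemma line_dist_eq:
  assumes V: "is_line V" and W: "is_line W"
    and v: "v \<in> V" "norm v = 1" and w: "w \<in> W" "norm w = 1"
  shows "line_dist V W = 2 * cmod (det (transpose (vector [v, w]) :: complex^2^2))"
  unfolding line_dist_def
proof (rule the_equality)
  show "\<exists>v'\<in>V. \<exists>w'\<in>W. norm v' = 1 \<and> norm w' = 1 \<and>
      2 * cmod (det (transpose (vector [v, w]) :: complex^2^2)) =
      2 * cmod (det (transpose (vector [v', w']) :: complex^2^2))"
    using v w by blast
next
  fix d
  assume "\<exists>v'\<in>V. \<exists>w'\<in>W. norm v' = 1 \<and> norm w' = 1 \<and>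
      d = 2 * cmod (det (transpose (vector [v', w']) :: complex^2^2))"
  then obtain v' w' where v': "v' \<in> V" "norm v' = 1" and w': "w' \<in> W" "norm w' = 1"
    and d: "d = 2 * cmod (det (transpose (vector [v', w']) :: complex^2^2))"
    by blast
  obtain a where a: "v' = a *s v" "cmod a = 1" by (rule is_line_unit_multiple[OF V v v'])
  obtain b where b: "w' = b *s w" "cmod b = 1" by (rule is_line_unit_multiple[OF W w w'])
  have "det (transpose (vector [v', w']) :: complex^2^2) =
      (a * b) * det (transpose (vector [v, w]) :: complex^2^2)"
    unfolding a b by (simp add: det_2 transpose_def algebra_simps)
  then show "d = 2 * cmod (det (transpose (vector [v, w]) :: complex^2^2))"
    unfolding d by (simp add: norm_mult a b)
qed

definition dominated_splitting :: "(int \<Rightarrow> complex^2^2) \<Rightarrow> bool" where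
  "dominated_splitting B \<longleftrightarrow>
    (\<exists>Eu Es :: int \<Rightarrow> (complex^2) set.
      (\<forall>j. is_line (Eu j) \<and> is_line (Es j)) \<and>
      (\<forall>j. (*v) (B j) ` Eu j \<subseteq> Eu (j + 1) \<and> (*v) (B j) ` Es j \<subseteq> Es (j + 1)) \<and>
      (\<exists>N::nat. \<exists>L::real. N > 0 \<and> L > 1 \<and>
        (\<forall>j. \<forall>u\<in>Eu j. \<forall>s\<in>Es j. norm u = 1 \<longrightarrow> norm s = 1 \<longrightarrow>
          norm (iterate B N j *v u) > L * norm (iterate B N j *v s)) \<and>
        (INF j. opnorm (iterate B N j)) > 0) \<and>
      (INF j. line_dist (Eu j) (Es j)) > 0)"

end

theory Submission
  imports Defs
begin

text \<open>
Put \<open>d = \<mu> powr (- 1 / 4)\<close>. Each matrix \<open>B j\<close> is close to rank one: up to an error of relative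
size \<open>d ^ 4\<close> it sends every vector into the line of its dominant output direction \<open>p\<close>. The lower
bound on the norms of the products \<open>B (j + 1) ** B j\<close> says that this output direction is not
annihilated by the next matrix: \<open>B (j + 1)\<close> stretches \<open>p\<close> by roughly at least \<open>d\<close> times its norm.
Hence the cones of vectors \<open>x\<close> that \<open>B j\<close> stretches by at least \<open>d / 2\<close> times \<open>opnorm (B j)\<close> are
mapped into each other: the image of such an \<open>x\<close> is within relative distance \<open>2 * d ^ 3\<close> of the
line of \<open>p\<close>. Moreover the next matrix stretches the image by the same factor as it stretches \<open>p\<close>,
that is, by
\<open>ratio j = opnorm (B (j + 1) ** B j) / opnorm (B j)\<close>, with a relative error of order
\<open>d ^ 3 / d = d\<^sup>2 = \<mu> powr (- 1 / 2)\<close> (\<open>cone_step\<close>).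

Iterating this along the orbit of a maximising vector of \<open>B j\<close> gives the lower bound for the norm
of a long product (\<open>opnorm_iterate_ge\<close>). For the upper bound (\<open>opnorm_iterate_le\<close>) an arbitrary
vector is split, after one step, into a multiple of \<open>p\<close>, whose growth is controlled by the cones,
and an error of relative size \<open>d ^ 4\<close>, whose growth is controlled by induction.

For the splitting, a compactness argument (\<open>bi_infinite_orbit\<close>) turns the invariance of the cones
into an orbit of lines that is indexed by all integers and stays in the cones; these lines are the
unstable ones. The stable lines are obtained from the same
construction for the reversed sequence of adjugates \<open>adjugate (B (- j))\<close>, which satisfies the same
hypotheses. If \<open>adjugate (B j)\<close> sends a unit vector \<open>y\<close> to a vector \<open>c *s x\<close>, then
\<open>B j\<close> sends \<open>c *s x\<close> to \<open>det (B j) *s y\<close>, so the expansion of the adjugates along the stable lines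
is contraction of \<open>B\<close>, and invariance holds even for singular \<open>B j\<close>. Since \<open>\<bar>det (B j)\<bar>\<close> is at most
\<open>d ^ 4 * (opnorm (B j))\<^sup>2\<close>, the stretching factors on the two lines differ by a factor of
at least \<open>4\<close>. So the domination already holds for single matrices, and it also keeps the two
lines uniformly apart.
\<close>

section \<open>Orbits indexed by the integers\<close>

text \<open>
Starting at time \<open>- n\<close>, an orbit can be followed forwards for ever. The sets of sequences that form
an orbit from time \<open>- n\<close> on are closed and decrease with \<open>n\<close>, so by the compactness of the product of the
\<open>V j\<close> some sequence lies in all of them.
\<close>

lemma bi_infinite_orbit:
  fixes V :: "int \<Rightarrow> 'a::topological_space set" and R :: "int \<Rightarrow> ('a \<times> 'a) set"
  assumes compact: "\<And>j. compact (V j)" and nonempty: "\<And>j. V j \<noteq> {}"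
    and closed: "\<And>j. closed (R j)"
    and step: "\<And>j x. x \<in> V j \<Longrightarrow> \<exists>y\<in>V (j + 1). (x, y) \<in> R j"
  shows "\<exists>u. \<forall>j. u j \<in> V j \<and> (u j, u (j + 1)) \<in> R j"
proof -
  define S where "S n = {u. \<forall>j\<ge>- int n. (u j, u (j + 1)) \<in> R j}" for n :: nat
  have closed_S: "closed (S n)" for n
  proof -
    have "S n = (\<Inter>j\<in>{- int n..}. (\<lambda>u. (u j, u (j + 1))) -` R j)"
      by (auto simp: S_def)
    moreover have "closed ((\<lambda>u. (u j, u (j + 1))) -` R j)" for j
      by (intro closed_vimage closed continuous_on_Pair continuous_on_product_coordinates)
    ultimately show ?thesis by auto
  qed
  have forward: "PiE UNIV V \<inter> S n \<noteq> {}" for n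
  proof -
    have "\<exists>f. \<forall>k. f k \<in> V (int k - int n) \<and>
        (f k, f (Suc k)) \<in> R (int k - int n)"
    proof (rule dependent_nat_choice)
      show "\<exists>x. x \<in> V (int 0 - int n)" using nonempty by blast
    next
      fix x k assume "x \<in> V (int k - int n)"
      from step[OF this] show "\<exists>y. y \<in> V (int (Suc k) - int n) \<and> (x, y) \<in> R (int k - int n)"
        by (auto simp: algebra_simps)
    qed
    then obtain f where f: "\<And>k. f k \<in> V (int k - int n)"
      "\<And>k. (f k, f (Suc k)) \<in> R (int k - int n)" by blast
    define u where "u j = (if j \<ge> - int n then f (nat (j + int n)) else (SOME x. x \<in> V j))" for j
    have "u j \<in> V j" for j
      using f(1)[of "nat (j + int n)"] nonempty[of j] by (auto simp: u_def intro: some_in_eq[THEN iffD2])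
    moreover have "(u j, u (j + 1)) \<in> R j" if "j \<ge> - int n" for j
    proof -
      have "nat (j + 1 + int n) = Suc (nat (j + int n))" using that by simp
      then show ?thesis using f(2)[of "nat (j + int n)"] that by (simp add: u_def)
    qed
    ultimately have "u \<in> PiE UNIV V \<inter> S n" by (auto simp: S_def)
    then show ?thesis by blast
  qed
  have "compactin (product_topology (\<lambda>_. euclidean) UNIV) (PiE UNIV V)"
    using compact by (auto simp: compactin_PiE)
  then have "compact (PiE UNIV V)"
    by (simp add: euclidean_product_topology)
  then have "PiE UNIV V \<inter> (\<Inter>n\<in>UNIV. S n) \<noteq> {}"
  proof (rule compact_imp_fip_image)
    fix I :: "nat set" assume "finite I"
    then obtain m where m: "\<forall>n\<in>I. n \<le> m"
      unfolding finite_nat_set_iff_bounded_le by (rule exE)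
    have "S m \<subseteq> (\<Inter>n\<in>I. S n)"
    proof
      fix u assume "u \<in> S m"
      then show "u \<in> (\<Inter>n\<in>I. S n)" using m unfolding S_def by fastforce
    qed
    then show "PiE UNIV V \<inter> (\<Inter>n\<in>I. S n) \<noteq> {}" using forward[of m] by blast
  qed (rule closed_S)
  then obtain u where u: "u \<in> PiE UNIV V" "\<And>n. u \<in> S n" by auto
  have "(u j, u (j + 1)) \<in> R j" for j
    using u(2)[of "nat \<bar>j\<bar>"] by (auto simp: S_def)
  then show ?thesis using u(1) by (intro exI[of _ u]) auto
qed

section \<open>Plane geometry and the operator norm\<close>

definition wedge :: "complex^2 \<Rightarrow> complex^2 \<Rightarrow> complex" where
  "wedge v w = v $ 1 * w $ 2 - v $ 2 * w $ 1"

lemma wedge_eq_det: "wedge v w = det (transpose (vector [v, w]) :: complex^2^2)"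
  by (simp add: wedge_def det_2 transpose_def)

lemma norm_vec2_power2: "(norm (v :: complex^2))\<^sup>2 = (cmod (v $ 1))\<^sup>2 + (cmod (v $ 2))\<^sup>2"
  by (simp add: norm_vec_def L2_set_def sum_2)

lemma norm_smult_vec2 [simp]: "norm (a *s (v :: complex^2)) = cmod a * norm v"
  by (simp add: norm_vec_def L2_set_right_distrib norm_mult)

lemma matrix_vector_mult_2:
  fixes A :: "complex^2^2"
  shows "(A *v x) $ i = A $ i $ 1 * x $ 1 + A $ i $ 2 * x $ 2"
  by (simp add: matrix_vector_mult_def sum_2)

lemma wedge_mult: "wedge (A *v v) (A *v w) = det A * wedge v w"
  by (simp add: wedge_def matrix_vector_mult_2 det_2 algebra_simps)

lemma wedge_smult_left [simp]: "wedge (a *s v) w = a * wedge v w"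
  by (simp add: wedge_def algebra_simps)

text \<open>
This replaces trigonometry: \<open>\<bar>wedge p v\<bar>\<close> is the distance of \<open>v\<close> from the line of \<open>p\<close>.
Together with \<open>wedge_mult\<close> it converts bounds on determinants into bounds on such distances.
\<close>
lemma orthogonal_split:
  fixes p v :: "complex^2"
  assumes p: "norm p = 1"
  obtains a e where "v = a *s p + e" "cmod a \<le> norm v" "norm e = cmod (wedge p v)"
proof
  define a where "a = cnj (p $ 1) * v $ 1 + cnj (p $ 2) * v $ 2"
  define n :: "complex^2" where "n = vector [- cnj (p $ 2), cnj (p $ 1)]"
  have pp: "p $ 1 * cnj (p $ 1) + p $ 2 * cnj (p $ 2) = 1"
    using norm_vec2_power2[of p] p
    by (simp only: complex_norm_square[symmetric] of_real_add[symmetric]) simp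
  have "v $ 1 = a * p $ 1 + wedge p v * n $ 1"
  proof -
    have "a * p $ 1 + wedge p v * n $ 1 = v $ 1 * (p $ 1 * cnj (p $ 1) + p $ 2 * cnj (p $ 2))"
      by (simp add: a_def n_def wedge_def algebra_simps)
    then show ?thesis by (simp add: pp)
  qed
  moreover have "v $ 2 = a * p $ 2 + wedge p v * n $ 2"
  proof -
    have "a * p $ 2 + wedge p v * n $ 2 = v $ 2 * (p $ 1 * cnj (p $ 1) + p $ 2 * cnj (p $ 2))"
      by (simp add: a_def n_def wedge_def algebra_simps)
    then show ?thesis by (simp add: pp)
  qed
  ultimately show "v = a *s p + wedge p v *s n"
    by (simp add: vec_eq_iff forall_2)
  have "(norm n)\<^sup>2 = (norm p)\<^sup>2"
    by (simp add: norm_vec2_power2 n_def)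
  then have "norm n = norm p" by (simp only: power2_eq_iff_nonneg norm_ge_zero)
  then have "norm n = 1" using p by simp
  then show "norm (wedge p v *s n) = cmod (wedge p v)" by simp
  \<comment> \<open>Pythagoras: \<open>p\<close> and \<open>n\<close> form an orthonormal basis, in which \<open>a\<close> and \<open>wedge p v\<close>
    are the coordinates of \<open>v\<close>.\<close>
  have "complex_of_real ((cmod a)\<^sup>2 + (cmod (wedge p v))\<^sup>2)
      = (v $ 1 * cnj (v $ 1) + v $ 2 * cnj (v $ 2)) * (p $ 1 * cnj (p $ 1) + p $ 2 * cnj (p $ 2))"
    unfolding of_real_add complex_norm_square
    by (simp add: a_def wedge_def algebra_simps)
  also have "\<dots> = complex_of_real ((norm v)\<^sup>2)"
    by (simp only: pp norm_vec2_power2 complex_norm_square of_real_add mult_1_right)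
  finally have "(cmod a)\<^sup>2 + (cmod (wedge p v))\<^sup>2 = (norm v)\<^sup>2"
    by (simp only: of_real_eq_iff)
  then have "(cmod a)\<^sup>2 \<le> (norm v)\<^sup>2"
    using zero_le_power2[of "cmod (wedge p v)"] by linarith
  then show "cmod a \<le> norm v" by (rule power2_le_imp_le) simp
qed

text \<open>Lagrange's identity: the squares of \<open>\<bar>wedge v w\<bar>\<close> and of the modulus of the Hermitian
product of \<open>v\<close> and \<open>w\<close> add up to the square of \<open>norm v * norm w\<close>.\<close>
lemma norm_wedge_le: "cmod (wedge v w) \<le> norm v * norm w"
proof (rule power2_le_imp_le)
  have "complex_of_real ((norm v * norm w)\<^sup>2) = complex_of_real ((cmod (wedge v w))\<^sup>2
      + (cmod (cnj (v $ 1) * w $ 1 + cnj (v $ 2) * w $ 2))\<^sup>2)"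
    unfolding power_mult_distrib norm_vec2_power2 of_real_mult of_real_add complex_norm_square
    by (simp add: wedge_def algebra_simps)
  then show "(cmod (wedge v w))\<^sup>2 \<le> (norm v * norm w)\<^sup>2"
    by (simp only: of_real_eq_iff) simp
qed simp

lemma wedge_eq_0_collinear:
  assumes "wedge x y = 0" "norm y = 1"
  obtains a where "x = a *s y"
proof -
  obtain a e where ae: "x = a *s y + e" "norm e = cmod (wedge y x)"
    by (rule orthogonal_split[OF assms(2)])
  moreover have "wedge y x = - wedge x y" by (simp add: wedge_def algebra_simps)
  ultimately have "norm e = 0" using assms(1) by (metis norm_minus_cancel norm_zero)
  then show thesis using ae(1) that[of a] by simp
qed

lemma bounded_linear_mult_vec: "bounded_linear ((*v) (A :: complex^2^2))"
  by (rule matrix_vector_mul_bounded_linear)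

lemma norm_mult_vec_le: "norm (A *v x) \<le> opnorm A * norm x"
  unfolding opnorm_def by (rule onorm[OF bounded_linear_mult_vec])

lemma opnorm_nonneg: "opnorm A \<ge> 0"
  unfolding opnorm_def by (rule onorm_pos_le[OF bounded_linear_mult_vec])

lemma opnorm_le:
  assumes "\<And>x. norm (A *v x) \<le> b * norm x"
  shows "opnorm A \<le> b"
  unfolding opnorm_def using assms by (rule onorm_le)

lemma opnorm_attained:
  obtains q where "norm q = 1" "norm (A *v q) = opnorm A"
proof -
  have "compact (sphere (0 :: complex^2) 1)" by simp
  moreover have "axis 1 1 \<in> sphere (0 :: complex^2) 1" by simp
  moreover have "continuous_on (sphere (0 :: complex^2) 1) (\<lambda>x. norm (A *v x))"
    by (intro continuous_on_norm linear_continuous_on bounded_linear_mult_vec)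
  ultimately obtain q where q: "q \<in> sphere (0 :: complex^2) 1"
    "\<And>x. x \<in> sphere 0 1 \<Longrightarrow> norm (A *v x) \<le> norm (A *v q)"
    using continuous_attains_sup[of "sphere (0 :: complex^2) 1" "\<lambda>x. norm (A *v x)"] by blast
  have "norm (A *v x) \<le> norm (A *v q) * norm x" for x
  proof (cases "x = 0")
    case False
    define y where "y = complex_of_real (inverse (norm x)) *s x"
    have x: "x = complex_of_real (norm x) *s y"
      using False by (simp add: y_def vec_eq_iff)
    have "norm y = 1" using False by (simp add: y_def norm_inverse)
    then have "norm (A *v y) \<le> norm (A *v q)" using q(2) by simp
    then have "norm x * norm (A *v y) \<le> norm x * norm (A *v q)"
      by (rule mult_left_mono) simp
    moreover have "norm (A *v x) = norm x * norm (A *v y)"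
      by (subst x) (simp add: vector_scalar_commute)
    ultimately show ?thesis by (simp add: mult.commute)
  qed simp
  then have "opnorm A \<le> norm (A *v q)" by (rule opnorm_le)
  moreover have "norm (A *v q) \<le> opnorm A" using norm_mult_vec_le[of A q] q(1) by simp
  ultimately show thesis using that q(1) by auto
qed

text \<open>
The part of the singular value decomposition that is needed. For a maximising unit vector \<open>q\<close> and
\<open>p = A q / opnorm A\<close>, the distance of \<open>A x\<close> from the line of \<open>p\<close> is the modulus of
\<open>det A * wedge q x / opnorm A\<close>, hence at most the second singular value times \<open>norm x\<close>.
\<close>
lemma top_singular_split:
  fixes A :: "complex^2^2"
  assumes A: "opnorm A > 0"
  obtains p q where "norm p = 1" "norm q = 1" "A *v q = complex_of_real (opnorm A) *s p"
    "\<And>x. \<exists>a e. A *v x = a *s p + e \<and> cmod a \<le> norm (A *v x)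
      \<and> norm e \<le> cmod (det A) / opnorm A * norm x"
proof -
  obtain q where q: "norm q = 1" "norm (A *v q) = opnorm A" by (rule opnorm_attained)
  define p where "p = complex_of_real (inverse (opnorm A)) *s (A *v q)"
  have p: "norm p = 1" using A by (simp add: p_def q norm_inverse)
  have "\<exists>a e. A *v x = a *s p + e \<and> cmod a \<le> norm (A *v x)
      \<and> norm e \<le> cmod (det A) / opnorm A * norm x" for x
  proof -
    obtain a e where ae: "A *v x = a *s p + e" "cmod a \<le> norm (A *v x)"
      "norm e = cmod (wedge p (A *v x))" by (rule orthogonal_split[OF p])
    have "cmod (wedge p (A *v x)) = inverse (opnorm A) * (cmod (det A) * cmod (wedge q x))"
      using A by (simp add: p_def wedge_mult norm_mult norm_inverse)
    also have "\<dots> \<le> inverse (opnorm A) * (cmod (det A) * norm x)"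
      using A norm_wedge_le[of q x] q by (intro mult_left_mono) auto
    finally have "norm e \<le> cmod (det A) / opnorm A * norm x"
      by (simp add: ae(3) divide_inverse ac_simps)
    then show ?thesis using ae(1,2) by blast
  qed
  then show thesis using p q(1) A by (intro that[of p q]) (auto simp: p_def vec_eq_iff)
qed

section \<open>Adjugates of matrices of size two\<close>

definition adjugate :: "complex^2^2 \<Rightarrow> complex^2^2" where
  "adjugate A = vector [vector [A $ 2 $ 2, - A $ 1 $ 2], vector [- A $ 2 $ 1, A $ 1 $ 1]]"

lemma adjugate_adjugate: "adjugate (adjugate A) = A"
  by (simp add: adjugate_def vec_eq_iff forall_2)

lemma det_adjugate: "det (adjugate A) = det A"
  by (simp add: adjugate_def det_2 algebra_simps)

lemma adjugate_mult: "adjugate (A ** B) = adjugate B ** adjugate A"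
  by (simp add: adjugate_def vec_eq_iff forall_2 matrix_matrix_mult_def sum_2 algebra_simps)

lemma mult_adjugate_vec: "A *v (adjugate A *v x) = det A *s x"
  by (simp add: adjugate_def vec_eq_iff forall_2 matrix_vector_mult_2 det_2 algebra_simps)

lemma wedge_adjugate: "wedge y (adjugate A *v x) = wedge (A *v y) x"
  by (simp add: adjugate_def wedge_def matrix_vector_mult_2 algebra_simps)

text \<open>
By \<open>wedge_adjugate\<close>, \<open>adjugate A\<close> is the transpose of \<open>A\<close> for the bilinear form \<open>wedge\<close>. The
norm is then computed by duality, because every \<open>z\<close> has a partner \<open>y\<close> of equal norm (\<open>z\<close> conjugated
and turned by a right angle) at which \<open>\<bar>wedge y z\<bar>\<close> attains its maximal value.
\<close>
lemma opnorm_adjugate: "opnorm (adjugate A) = opnorm A"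
proof -
  have le: "opnorm (adjugate A) \<le> opnorm A" for A
  proof (rule opnorm_le)
    fix x
    define z where "z = adjugate A *v x"
    define y :: "complex^2" where "y = vector [- cnj (z $ 2), cnj (z $ 1)]"
    have "(norm y)\<^sup>2 = (norm z)\<^sup>2" by (simp add: norm_vec2_power2 y_def)
    then have y: "norm y = norm z" by (simp add: power2_eq_iff_nonneg)
    have "wedge y z = - complex_of_real ((norm z)\<^sup>2)"
      unfolding norm_vec2_power2 of_real_add complex_norm_square
      by (simp add: wedge_def y_def algebra_simps)
    then have "(norm z)\<^sup>2 = cmod (wedge y z)" by (simp only: norm_minus_cancel norm_of_real) simp
    also have "\<dots> = cmod (wedge (A *v y) x)" by (simp add: z_def wedge_adjugate)
    also have "\<dots> \<le> norm (A *v y) * norm x" by (rule norm_wedge_le)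
    also have "\<dots> \<le> opnorm A * norm z * norm x"
      using norm_mult_vec_le[of A y] by (intro mult_right_mono) (auto simp: y)
    finally have "norm z * norm z \<le> norm z * (opnorm A * norm x)"
      by (simp add: power2_eq_square ac_simps)
    then show "norm (adjugate A *v x) \<le> opnorm A * norm x"
      using opnorm_nonneg[of A] by (cases "norm z = 0") (auto simp: z_def[symmetric])
  qed
  from le[of A] le[of "adjugate A"] show ?thesis by (simp add: adjugate_adjugate)
qed

lemma is_line_span:
  assumes "norm (v :: complex^2) = 1"
  shows "is_line (vec.span {v})"
proof -
  have "vec.independent {v}" using assms by auto
  then have "vec.dim {v} = card {v}" by (rule vec.dim_eq_card_independent)
  then show ?thesis by (simp add: is_line_def)
qed

lemma iterate_Suc_front: "iterate B (Suc n) j = iterate B n (j + 1) ** B j"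
proof (induction n)
  case (Suc n)
  have "iterate B (Suc (Suc n)) j = B (j + int (Suc n)) ** (iterate B n (j + 1) ** B j)"
    using Suc by simp
  moreover have "iterate B (Suc n) (j + 1) = B (j + int (Suc n)) ** iterate B n (j + 1)"
    by (simp add: algebra_simps)
  ultimately show ?case by (simp only: matrix_mul_assoc)
qed simp

section \<open>Invariant cones\<close>

text \<open>
With \<open>d = \<mu> powr (- 1 / 4)\<close> these are the hypotheses on singular values, freed from
quotients. They are preserved by the passage to the reversed adjugates (\<open>reversed\<close>), so that
whatever is proved about the forward dynamics also holds backwards.
\<close>
locale aligned_products =
  fixes B :: "int \<Rightarrow> complex^2^2" and d :: real
  assumes d_pos: "0 < d" and d_le: "d \<le> 1 / 4"
    and norm_pos: "\<And>j. opnorm (B j) > 0"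
    and det_le: "\<And>j. cmod (det (B j)) \<le> d ^ 4 * (opnorm (B j))\<^sup>2"
    and aligned: "\<And>j. d * (opnorm (B (j + 1)) * opnorm (B j)) \<le> opnorm (B (j + 1) ** B j)"
begin

text \<open>
Up to a relative error of order \<open>d ^ 3\<close>, the factor by which \<open>B (j + 1)\<close> stretches the dominant output
direction of \<open>B j\<close>.
\<close>
definition ratio :: "int \<Rightarrow> real" where
  "ratio j = opnorm (B (j + 1) ** B j) / opnorm (B j)"

definition cone :: "int \<Rightarrow> (complex^2) set" where
  "cone j = {x. d / 2 * opnorm (B j) * norm x \<le> norm (B j *v x)}"

lemma ratio_ge: "d * opnorm (B (j + 1)) \<le> ratio j"
  using aligned[of j] norm_pos[of j] by (simp add: ratio_def field_simps)

lemma ratio_pos: "ratio j > 0"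
  using ratio_ge[of j] norm_pos[of "j + 1"] d_pos
  by (meson less_le_trans mult_pos_pos)

lemma d3_le: "d ^ 3 \<le> d\<^sup>2 / 4"
  using d_le mult_left_mono[OF d_le, of "d\<^sup>2"] by (simp add: power2_eq_square power3_eq_cube)

lemma d2_le: "d\<^sup>2 \<le> 1 / 16"
  using power_mono[OF d_le, of 2] d_pos by (simp add: power2_eq_square)

text \<open>
Applying \<open>B (j + 1)\<close> to \<open>B j *v q = opnorm (B j) *s p\<close> bounds its stretching of \<open>p\<close> from above by
\<open>ratio j\<close>. Conversely every \<open>B j *v x\<close> is a multiple of \<open>p\<close> up to the second singular value, so the
norm of \<open>B (j + 1) ** B j\<close> cannot be much larger than what \<open>p\<close> accounts for.
\<close>
lemma singular_split:
  obtains p q where "norm p = 1" "norm q = 1" "B j *v q = complex_of_real (opnorm (B j)) *s p"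
    "\<And>x. \<exists>a e. B j *v x = a *s p + e \<and> cmod a \<le> norm (B j *v x)
      \<and> norm e \<le> d ^ 4 * opnorm (B j) * norm x"
    "norm (B (j + 1) *v p) \<le> ratio j"
    "ratio j - d ^ 4 * opnorm (B (j + 1)) \<le> norm (B (j + 1) *v p)"
proof -
  define s where "s = opnorm (B j)"
  define S where "S = opnorm (B (j + 1))"
  have s: "s > 0" and S: "S > 0" using norm_pos by (auto simp: s_def S_def)
  obtain p q where pq: "norm p = 1" "norm q = 1" "B j *v q = complex_of_real s *s p"
    and split: "\<And>x. \<exists>a e. B j *v x = a *s p + e \<and> cmod a \<le> norm (B j *v x)
      \<and> norm e \<le> cmod (det (B j)) / s * norm x"
    unfolding s_def by (rule top_singular_split[OF norm_pos[of j]]) blast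
  have det: "cmod (det (B j)) / s \<le> d ^ 4 * s"
    using det_le[of j] s by (simp add: s_def[symmetric] field_simps power2_eq_square)
  have split': "\<exists>a e. B j *v x = a *s p + e \<and> cmod a \<le> norm (B j *v x)
      \<and> norm e \<le> d ^ 4 * s * norm x" for x
  proof -
    obtain a e where "B j *v x = a *s p + e" "cmod a \<le> norm (B j *v x)"
      "norm e \<le> cmod (det (B j)) / s * norm x" using split by blast
    moreover from this(3) have "norm e \<le> d ^ 4 * s * norm x"
      using mult_right_mono[OF det norm_ge_zero[of x]] by linarith
    ultimately show ?thesis by blast
  qed
  let ?\<tau> = "norm (B (j + 1) *v p)"
  have "s * ?\<tau> = norm ((B (j + 1) ** B j) *v q)"
    using s by (simp add: matrix_vector_mul_assoc[symmetric] pq vector_scalar_commute)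
  also have "\<dots> \<le> opnorm (B (j + 1) ** B j)"
    using norm_mult_vec_le[of "B (j + 1) ** B j" q] pq by simp
  finally have "?\<tau> \<le> ratio j" using s by (simp add: ratio_def s_def[symmetric] field_simps)
  have "opnorm (B (j + 1) ** B j) \<le> s * (?\<tau> + d ^ 4 * S)"
  proof (rule opnorm_le)
    fix x
    obtain a e where ae: "B j *v x = a *s p + e" "cmod a \<le> norm (B j *v x)"
      "norm e \<le> d ^ 4 * s * norm x" using split' by blast
    have a: "cmod a \<le> s * norm x" using ae(2) norm_mult_vec_le[of "B j" x] by (simp add: s_def)
    have "(B (j + 1) ** B j) *v x = a *s (B (j + 1) *v p) + B (j + 1) *v e"
      by (simp add: matrix_vector_mul_assoc[symmetric] ae(1) matrix_vector_right_distrib vector_scalar_commute)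
    then have "norm ((B (j + 1) ** B j) *v x) \<le> cmod a * ?\<tau> + norm (B (j + 1) *v e)"
      using norm_triangle_ineq[of "a *s (B (j + 1) *v p)" "B (j + 1) *v e"] by simp
    also have "\<dots> \<le> s * norm x * ?\<tau> + S * (d ^ 4 * s * norm x)"
    proof (rule add_mono)
      show "cmod a * ?\<tau> \<le> s * norm x * ?\<tau>" using a by (rule mult_right_mono) simp
      have "norm (B (j + 1) *v e) \<le> S * norm e" unfolding S_def by (rule norm_mult_vec_le)
      also have "\<dots> \<le> S * (d ^ 4 * s * norm x)" using ae(3) S by (intro mult_left_mono) auto
      finally show "norm (B (j + 1) *v e) \<le> S * (d ^ 4 * s * norm x)" .
    qed
    finally show "norm ((B (j + 1) ** B j) *v x) \<le> s * (?\<tau> + d ^ 4 * S) * norm x"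
      by (simp add: algebra_simps)
  qed
  then have "ratio j - d ^ 4 * S \<le> ?\<tau>"
    using s by (simp add: ratio_def s_def[symmetric] field_simps)
  with \<open>?\<tau> \<le> ratio j\<close> show thesis
    using that[of p q] pq split' by (simp add: s_def S_def)
qed

lemma cone_maximal:
  assumes "norm q = 1" "norm (B j *v q) = opnorm (B j)"
  shows "q \<in> cone j"
  using assms mult_right_mono[of "d / 2" 1 "opnorm (B j)"] d_le norm_pos[of j]
  by (simp add: cone_def)

text \<open>
For \<open>x\<close> in the cone, \<open>w = B j *v x\<close> is not small, so the error of size \<open>d ^ 4 * opnorm (B j) * norm x\<close>
in its distance from the line of \<open>p\<close> is at most \<open>2 * d ^ 3 * norm w\<close>. After \<open>B (j + 1)\<close> is applied,
this error is compared with \<open>ratio j \<ge> d * opnorm (B (j + 1))\<close>, which costs one more power of \<open>d\<close>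
and leaves \<open>2 * d\<^sup>2\<close>. The lower bound loses another \<open>d\<^sup>2\<close>, from replacing \<open>w\<close> by its component
along \<open>p\<close> and the stretching of \<open>p\<close> by \<open>ratio j\<close>. As \<open>1 - 3 * d\<^sup>2 \<ge> 1 / 2\<close>, the image lies in the next cone.
\<close>
lemma cone_step:
  assumes x: "x \<in> cone j"
  defines "w \<equiv> B j *v x"
  shows "norm (B (j + 1) *v w) \<le> (1 + 2 * d\<^sup>2) * ratio j * norm w" (is ?upper)
    and "(1 - 3 * d\<^sup>2) * ratio j * norm w \<le> norm (B (j + 1) *v w)" (is ?lower)
    and "w \<in> cone (j + 1)"
proof -
  define s S t where "s = opnorm (B j)" and "S = opnorm (B (j + 1))" and "t = ratio j"
  have pos: "s > 0" "S > 0" "t > 0" using norm_pos ratio_pos by (auto simp: s_def S_def t_def)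
  have St: "d * S \<le> t" using ratio_ge by (simp add: S_def t_def)
  obtain p where p1: "norm p = 1" and p: "norm (B (j + 1) *v p) \<le> t" "t - d ^ 4 * S \<le> norm (B (j + 1) *v p)"
    and split: "\<exists>a e. w = a *s p + e \<and> cmod a \<le> norm w \<and> norm e \<le> d ^ 4 * s * norm x"
    unfolding w_def t_def S_def s_def by (rule singular_split[of j]) blast
  let ?\<tau> = "norm (B (j + 1) *v p)"
  from split obtain a e where ae: "w = a *s p + e" "cmod a \<le> norm w"
    "norm e \<le> d ^ 4 * s * norm x" by blast
  have "d ^ 4 * s * norm x = 2 * d ^ 3 * (d / 2 * s * norm x)"
    by (simp add: power_numeral_reduce)
  also have "\<dots> \<le> 2 * d ^ 3 * norm w"
    using x d_pos by (intro mult_left_mono) (auto simp: cone_def w_def s_def)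
  finally have e: "norm e \<le> 2 * d ^ 3 * norm w" using ae(3) by simp
  have Be: "norm (B (j + 1) *v e) \<le> 2 * d\<^sup>2 * t * norm w"
  proof -
    have "norm (B (j + 1) *v e) \<le> S * norm e" using norm_mult_vec_le by (simp add: S_def)
    also have "\<dots> \<le> S * (2 * d ^ 3 * norm w)" using e pos by (intro mult_left_mono) auto
    also have "\<dots> = 2 * d\<^sup>2 * norm w * (d * S)" by (simp add: power_numeral_reduce)
    also have "\<dots> \<le> 2 * d\<^sup>2 * norm w * t" using St by (intro mult_left_mono) auto
    finally show ?thesis by (simp add: ac_simps)
  qed
  have Bw: "B (j + 1) *v w = a *s (B (j + 1) *v p) + B (j + 1) *v e"
    by (simp add: ae(1) matrix_vector_right_distrib vector_scalar_commute)
  have "norm (B (j + 1) *v w) \<le> cmod a * ?\<tau> + norm (B (j + 1) *v e)"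
    unfolding Bw using norm_triangle_ineq[of "a *s (B (j + 1) *v p)" "B (j + 1) *v e"] by simp
  moreover have "cmod a * ?\<tau> \<le> norm w * t" using ae(2) p pos by (intro mult_mono) auto
  ultimately show ?upper using Be by (simp add: t_def algebra_simps)
  have "cmod a * ?\<tau> - norm (B (j + 1) *v e) \<le> norm (B (j + 1) *v w)"
    unfolding Bw using norm_diff_ineq[of "a *s (B (j + 1) *v p)" "B (j + 1) *v e"] by simp
  moreover have "(1 - d\<^sup>2) * t * norm w \<le> cmod a * ?\<tau>"
  proof -
    have "norm w \<le> cmod a * norm p + norm e"
      using ae(1) norm_triangle_ineq[of "a *s p" e] by simp
    then have a: "(1 - 2 * d ^ 3) * norm w \<le> cmod a" using e p1 by (simp add: algebra_simps)
    have "d ^ 4 * S \<le> d ^ 3 * t"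
      using mult_left_mono[OF St, of "d ^ 3"] d_pos by (simp add: power_numeral_reduce)
    then have \<tau>: "(1 - d ^ 3) * t \<le> ?\<tau>" using p(2) by (simp add: algebra_simps)
    have "1 - d\<^sup>2 \<le> (1 - 2 * d ^ 3) * (1 - d ^ 3)"
    proof -
      have "(1 - 2 * d ^ 3) * (1 - d ^ 3) = 1 - 3 * d ^ 3 + 2 * (d ^ 3 * d ^ 3)"
        by (simp add: algebra_simps)
      moreover have "0 \<le> d\<^sup>2" "0 \<le> d ^ 3 * d ^ 3" by auto
      ultimately show ?thesis using d3_le by linarith
    qed
    then have "(1 - d\<^sup>2) * (t * norm w) \<le> (1 - 2 * d ^ 3) * (1 - d ^ 3) * (t * norm w)"
      using pos by (intro mult_right_mono) auto
    also have "\<dots> = (1 - 2 * d ^ 3) * norm w * ((1 - d ^ 3) * t)" by simp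
    also have "\<dots> \<le> cmod a * ?\<tau>"
    proof (rule mult_mono[OF a \<tau>])
      show "0 \<le> cmod a" by simp
      have "0 \<le> 1 - d ^ 3" using d3_le d2_le by linarith
      then show "0 \<le> (1 - d ^ 3) * t" using pos by simp
    qed
    finally show ?thesis by (simp add: mult.assoc)
  qed
  ultimately show lower: ?lower using Be by (simp add: t_def algebra_simps)
  have "d / 2 * S * norm w \<le> t / 2 * norm w" using St by (intro mult_right_mono) auto
  also have "\<dots> \<le> (1 - 3 * d\<^sup>2) * t * norm w"
    using d2_le pos by (intro mult_right_mono) auto
  finally show "w \<in> cone (j + 1)" using lower by (simp add: cone_def S_def t_def)
qed

lemma cone_iterate:
  assumes x: "x \<in> cone j"
  shows "iterate B n j *v x \<in> cone (j + int n)"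
    and "norm (iterate B (Suc n) j *v x)
      \<le> (1 + 2 * d\<^sup>2) ^ n * (\<Prod>k<n. ratio (j + int k)) * norm (B j *v x)"
    and "(1 - 3 * d\<^sup>2) ^ n * (\<Prod>k<n. ratio (j + int k)) * norm (B j *v x)
      \<le> norm (iterate B (Suc n) j *v x)"
proof (induction n)
  case 0
  { case 1 show ?case using x by simp }
  { case 2 show ?case by simp }
  { case 3 show ?case by simp }
next
  case (Suc n)
  let ?y = "iterate B n j *v x" and ?i = "j + int n"
  have next_j: "j + int (Suc n) = ?i + 1" by simp
  have y: "iterate B (Suc n) j *v x = B ?i *v ?y"
    by (simp add: matrix_vector_mul_assoc)
  have y': "iterate B (Suc (Suc n)) j *v x = B (?i + 1) *v (B ?i *v ?y)"
    unfolding iterate.simps(2)[of B "Suc n"] next_j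
    by (simp only: y flip: matrix_vector_mul_assoc)
  note step = cone_step[OF Suc(1)]
  { case 1 show ?case unfolding y next_j by (rule step(3)) }
  { case 2
    have "norm (B (?i + 1) *v (B ?i *v ?y)) \<le> (1 + 2 * d\<^sup>2) * ratio ?i * norm (B ?i *v ?y)"
      by (rule step(1))
    also have "\<dots> \<le> (1 + 2 * d\<^sup>2) * ratio ?i *
        ((1 + 2 * d\<^sup>2) ^ n * (\<Prod>k<n. ratio (j + int k)) * norm (B j *v x))"
      using Suc(2) ratio_pos[of ?i] unfolding y by (intro mult_left_mono) auto
    finally show ?case unfolding y' by (simp add: ac_simps) }
  { case 3
    have "(1 - 3 * d\<^sup>2) * ratio ?i *
        ((1 - 3 * d\<^sup>2) ^ n * (\<Prod>k<n. ratio (j + int k)) * norm (B j *v x))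
        \<le> (1 - 3 * d\<^sup>2) * ratio ?i * norm (B ?i *v ?y)"
      using Suc(3) ratio_pos[of ?i] d2_le unfolding y by (intro mult_left_mono) auto
    also have "\<dots> \<le> norm (B (?i + 1) *v (B ?i *v ?y))"
      by (rule step(2))
    finally show ?case unfolding y' by (simp add: ac_simps) }
qed

section \<open>Norms of long products\<close>

lemma opnorm_iterate_ge:
  "(1 - 3 * d\<^sup>2) ^ n * (opnorm (B j) * (\<Prod>k<n. ratio (j + int k))) \<le> opnorm (iterate B (Suc n) j)"
proof -
  obtain q where q: "norm q = 1" "norm (B j *v q) = opnorm (B j)" by (rule opnorm_attained)
  have "q \<in> cone j" by (rule cone_maximal[OF q])
  from cone_iterate(3)[OF this, of n] norm_mult_vec_le[of "iterate B (Suc n) j" q]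
  show ?thesis unfolding q by (simp add: ac_simps)
qed

text \<open>
A maximising vector of the long product need not lie in the cone, so the first factor is split off.
The image of any \<open>x\<close> under \<open>B j\<close> is a multiple of \<open>p\<close>, for which the remaining product is controlled through
\<open>q\<close>, plus an error of size \<open>d ^ 4\<close>. The induction hypothesis compares the error with the norm of
\<open>B (j + 1)\<close> instead of \<open>ratio j\<close>; this costs a factor \<open>1 / d\<close>, and the remaining \<open>d ^ 3 \<le> d\<^sup>2\<close> is absorbed by
the passage from \<open>2 * d\<^sup>2\<close> to \<open>3 * d\<^sup>2\<close>.
\<close>
lemma opnorm_iterate_le:
  "opnorm (iterate B (Suc n) j) \<le> (1 + 3 * d\<^sup>2) ^ n * (opnorm (B j) * (\<Prod>k<n. ratio (j + int k)))"
proof (induction n arbitrary: j)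
  case 0 show ?case by simp
next
  case (Suc n)
  define s where "s = opnorm (B j)"
  define S where "S = opnorm (B (j + 1))"
  define P where "P = (\<Prod>k<n. ratio (j + 1 + int k))"
  define X where "X = opnorm (iterate B (Suc n) (j + 1))"
  have pos: "s > 0" "S > 0" "P > 0" "ratio j > 0"
    using norm_pos ratio_pos by (auto simp: s_def S_def P_def intro!: prod_pos)
  have X0: "X \<ge> 0" by (simp only: X_def opnorm_nonneg)
  have prod: "(\<Prod>k<Suc n. ratio (j + int k)) = ratio j * P"
    unfolding prod.lessThan_Suc_shift P_def by (simp add: ac_simps)
  obtain p q where pq: "norm p = 1" "norm q = 1" "B j *v q = complex_of_real s *s p"
    and split: "\<And>x. \<exists>a e. B j *v x = a *s p + e \<and> cmod a \<le> norm (B j *v x)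
      \<and> norm e \<le> d ^ 4 * s * norm x"
    unfolding s_def by (rule singular_split[of j]) blast
  have Bq: "norm (B j *v q) = s" using pos by (simp add: pq)
  have "q \<in> cone j" using Bq pq by (intro cone_maximal) (simp_all add: s_def)
  note top = cone_iterate(2)[OF this, of "Suc n", unfolded prod Bq]
  have top': "s * norm (iterate B (Suc n) (j + 1) *v p) \<le> (1 + 2 * d\<^sup>2) ^ Suc n * (ratio j * P) * s"
  proof -
    have "iterate B (Suc (Suc n)) j *v q = complex_of_real s *s (iterate B (Suc n) (j + 1) *v p)"
      unfolding iterate_Suc_front[of B "Suc n"]
      by (simp only: matrix_vector_mul_assoc[symmetric] pq vector_scalar_commute)
    then show ?thesis using top pos by (simp only: norm_smult_vec2) simp
  qed
  have top: "norm (iterate B (Suc n) (j + 1) *v p) \<le> (1 + 2 * d\<^sup>2) ^ Suc n * (ratio j * P)"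
  proof (rule mult_left_le_imp_le)
    show "s * norm (iterate B (Suc n) (j + 1) *v p) \<le> s * ((1 + 2 * d\<^sup>2) ^ Suc n * (ratio j * P))"
      using top' by (simp only: mult.commute)
  qed (rule pos)
  have rest: "d ^ 4 * X \<le> d ^ 3 * ((1 + 3 * d\<^sup>2) ^ n * (ratio j * P))"
  proof -
    have "d ^ 4 * X \<le> d ^ 4 * ((1 + 3 * d\<^sup>2) ^ n * (S * P))"
      using Suc[of "j + 1"] unfolding X_def S_def P_def by (intro mult_left_mono) auto
    also have "\<dots> = d ^ 3 * ((1 + 3 * d\<^sup>2) ^ n * (d * S * P))"
      by (simp add: power_numeral_reduce)
    also have "\<dots> \<le> d ^ 3 * ((1 + 3 * d\<^sup>2) ^ n * (ratio j * P))"
      using ratio_ge[of j] pos d_pos by (intro mult_left_mono mult_right_mono) (auto simp: S_def)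
    finally show ?thesis .
  qed
  have coeff: "(1 + 2 * d\<^sup>2) ^ Suc n + d ^ 3 * (1 + 3 * d\<^sup>2) ^ n \<le> (1 + 3 * d\<^sup>2) ^ Suc n"
  proof -
    have "(1 + 2 * d\<^sup>2) ^ n \<le> (1 + 3 * d\<^sup>2) ^ n" by (intro power_mono) auto
    then have "(1 + 2 * d\<^sup>2) ^ Suc n \<le> (1 + 2 * d\<^sup>2) * (1 + 3 * d\<^sup>2) ^ n"
      by (simp add: mult_left_mono)
    moreover have "d ^ 3 * (1 + 3 * d\<^sup>2) ^ n \<le> d\<^sup>2 * (1 + 3 * d\<^sup>2) ^ n"
      using d3_le zero_le_power2[of d] by (intro mult_right_mono) (linarith, simp)
    ultimately show ?thesis by (simp add: algebra_simps)
  qed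
  have "opnorm (iterate B (Suc (Suc n)) j)
      \<le> s * (norm (iterate B (Suc n) (j + 1) *v p) + d ^ 4 * X)"
  proof (rule opnorm_le)
    fix x
    let ?T = "iterate B (Suc n) (j + 1)"
    obtain a e where ae: "B j *v x = a *s p + e" "cmod a \<le> norm (B j *v x)"
      "norm e \<le> d ^ 4 * s * norm x" using split by blast
    have a: "cmod a \<le> s * norm x" using ae(2) norm_mult_vec_le[of "B j" x] by (simp add: s_def)
    have "iterate B (Suc (Suc n)) j *v x = a *s (?T *v p) + ?T *v e"
      unfolding iterate_Suc_front[of B "Suc n"]
      by (simp only: matrix_vector_mul_assoc[symmetric] ae(1) matrix_vector_right_distrib
          vector_scalar_commute)
    then have "norm (iterate B (Suc (Suc n)) j *v x) \<le> cmod a * norm (?T *v p) + norm (?T *v e)"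
      using norm_triangle_ineq[of "a *s (?T *v p)" "?T *v e"] by (simp only: norm_smult_vec2)
    also have "\<dots> \<le> s * norm x * norm (?T *v p) + X * (d ^ 4 * s * norm x)"
    proof (rule add_mono)
      show "cmod a * norm (?T *v p) \<le> s * norm x * norm (?T *v p)"
        using a by (rule mult_right_mono) (rule norm_ge_zero)
      have "norm (?T *v e) \<le> X * norm e" unfolding X_def by (rule norm_mult_vec_le)
      also have "\<dots> \<le> X * (d ^ 4 * s * norm x)" using ae(3) X0 by (rule mult_left_mono)
      finally show "norm (?T *v e) \<le> X * (d ^ 4 * s * norm x)" .
    qed
    finally show "norm (iterate B (Suc (Suc n)) j *v x) \<le> s * (norm (?T *v p) + d ^ 4 * X) * norm x"
      by (simp only: ring_distribs mult.assoc mult.commute mult.left_commute)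
  qed
  also have "\<dots> \<le> s * ((1 + 2 * d\<^sup>2) ^ Suc n * (ratio j * P)
      + d ^ 3 * ((1 + 3 * d\<^sup>2) ^ n * (ratio j * P)))"
    using pos by (intro mult_left_mono add_mono top rest) auto
  also have "\<dots> = ((1 + 2 * d\<^sup>2) ^ Suc n + d ^ 3 * (1 + 3 * d\<^sup>2) ^ n) * (s * (ratio j * P))"
    by (simp only: ring_distribs mult.assoc mult.commute mult.left_commute)
  also have "\<dots> \<le> (1 + 3 * d\<^sup>2) ^ Suc n * (s * (ratio j * P))"
    using pos by (intro mult_right_mono coeff) auto
  finally show ?case unfolding prod s_def .
qed

section \<open>The invariant lines\<close>

text \<open>
The lines are represented by unit vectors; the condition on \<open>wedge\<close>, which says that the line of
\<open>u j\<close> is mapped into the line of \<open>u (j + 1)\<close>, is closed and leaves the phases free.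
\<close>
lemma cone_orbit:
  "\<exists>u. \<forall>j. norm (u j) = 1 \<and> u j \<in> cone j \<and> wedge (B j *v u j) (u (j + 1)) = 0"
proof -
  define V where "V j = sphere 0 1 \<inter> cone j" for j
  define R where "R j = {(x, y). wedge (B j *v x) y = 0}" for j
  have cont: "continuous_on UNIV (\<lambda>x. B j *v x)" for j
    by (intro linear_continuous_on bounded_linear_mult_vec)
  have "\<exists>u. \<forall>j. u j \<in> V j \<and> (u j, u (j + 1)) \<in> R j"
  proof (rule bi_infinite_orbit)
    fix j
    have "closed (cone j)"
      unfolding cone_def by (intro closed_Collect_le continuous_intros cont)
    then show "compact (V j)" unfolding V_def by (intro compact_Int_closed) auto
    obtain q where "norm q = 1" "norm (B j *v q) = opnorm (B j)" by (rule opnorm_attained)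
    then have "q \<in> V j" by (simp add: V_def cone_maximal)
    then show "V j \<noteq> {}" by blast
    have "continuous_on UNIV (\<lambda>z :: (complex^2) \<times> (complex^2). B j *v fst z)"
      by (rule continuous_on_compose2[OF cont]) (auto intro: continuous_intros)
    then have "closed {z. wedge (B j *v fst z) (snd z) = 0}"
      unfolding wedge_def by (intro closed_Collect_eq continuous_intros)
    moreover have "R j = {z. wedge (B j *v fst z) (snd z) = 0}" by (auto simp: R_def)
    ultimately show "closed (R j)" by simp
    fix x assume x: "x \<in> V j"
    let ?w = "B j *v x"
    have "0 < d / 2 * opnorm (B j)" using d_pos norm_pos by simp
    also have "\<dots> \<le> norm ?w" using x by (auto simp: V_def cone_def)
    finally have "norm ?w > 0" .
    define y where "y = complex_of_real (inverse (norm ?w)) *s ?w"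
    have "norm y = 1" using \<open>norm ?w > 0\<close> by (simp add: y_def norm_inverse)
    moreover have "y \<in> cone (j + 1)"
    proof -
      have "?w \<in> cone (j + 1)" using x by (intro cone_step(3)) (simp add: V_def)
      then have "inverse (norm ?w) * (d / 2 * opnorm (B (j + 1)) * norm ?w)
          \<le> inverse (norm ?w) * norm (B (j + 1) *v ?w)"
        by (intro mult_left_mono) (auto simp: cone_def)
      then show ?thesis
        by (simp add: cone_def y_def vector_scalar_commute norm_inverse ac_simps)
    qed
    moreover have "wedge ?w y = 0" by (simp add: y_def wedge_def)
    ultimately show "\<exists>y\<in>V (j + 1). (x, y) \<in> R j" by (auto simp: V_def R_def)
  qed
  then show ?thesis by (simp add: V_def R_def)
qed

lemma reversed: "aligned_products (\<lambda>j. adjugate (B (- j))) d"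
proof
  fix j
  show "d * (opnorm (adjugate (B (- (j + 1)))) * opnorm (adjugate (B (- j))))
      \<le> opnorm (adjugate (B (- (j + 1))) ** adjugate (B (- j)))"
    using aligned[of "- (j + 1)"]
    by (simp add: adjugate_mult[symmetric] opnorm_adjugate ac_simps)
qed (use d_pos d_le norm_pos det_le in \<open>simp_all add: det_adjugate opnorm_adjugate\<close>)

text \<open>
The vectors \<open>s j\<close> come from the cone orbit of the reversed adjugates. Since \<open>adjugate (B j)\<close> maps
\<open>s (j + 1)\<close> to \<open>c *s s j\<close> with \<open>\<bar>c\<bar> \<ge> d / 2 * opnorm (B j)\<close>, \<open>B j\<close> maps \<open>s j\<close> to
\<open>(det (B j) / c) *s s (j + 1)\<close>, a vector of norm at most \<open>2 * d ^ 3 * opnorm (B j)\<close>; and \<open>2 * d ^ 3 \<le> d / 8\<close>.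
\<close>
lemma splitting_vectors:
  obtains u s where "\<And>j. norm (u j) = 1" "\<And>j. norm (s j) = 1"
    "\<And>j. \<exists>a. B j *v u j = a *s u (j + 1)" "\<And>j. \<exists>a. B j *v s j = a *s s (j + 1)"
    "\<And>j. d / 2 * opnorm (B j) \<le> norm (B j *v u j)"
    "\<And>j. norm (B j *v s j) \<le> d / 8 * opnorm (B j)"
proof -
  interpret rev: aligned_products "\<lambda>j. adjugate (B (- j))" d by (rule reversed)
  obtain u where u: "\<And>j. norm (u j) = 1" "\<And>j. u j \<in> cone j"
    "\<And>j. wedge (B j *v u j) (u (j + 1)) = 0" using cone_orbit by blast
  obtain w where w: "\<And>j. norm (w j) = 1" "\<And>j. w j \<in> rev.cone j"
    "\<And>j. wedge (adjugate (B (- j)) *v w j) (w (j + 1)) = 0" using rev.cone_orbit by blast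
  \<comment> \<open>\<open>adjugate (B j)\<close> has index \<open>- j\<close> in the reversed sequence and leads from \<open>w (- j)\<close> to
    \<open>w (1 - j)\<close>. It has to lead from \<open>s (j + 1)\<close> to \<open>s j\<close>, which forces the shift by one.\<close>
  define s where "s j = w (1 - j)" for j
  have s: "\<exists>a. B j *v s j = a *s s (j + 1) \<and> cmod a \<le> d / 8 * opnorm (B j)" for j
  proof -
    obtain c where c: "adjugate (B j) *v s (j + 1) = c *s s j"
      using wedge_eq_0_collinear[OF w(3)[of "- j"] w(1)] by (auto simp: s_def)
    have "d / 2 * opnorm (B j) \<le> norm (adjugate (B j) *v s (j + 1))"
      using w(2)[of "- j"] by (simp add: rev.cone_def s_def w(1) opnorm_adjugate)
    then have c_ge: "d / 2 * opnorm (B j) \<le> cmod c" by (simp add: c) (simp add: s_def w(1))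
    then have c0: "cmod c > 0" using d_pos norm_pos[of j] by (smt (verit) half_gt_zero mult_pos_pos)
    have "c *s (B j *v s j) = det (B j) *s s (j + 1)"
      using mult_adjugate_vec[of "B j" "s (j + 1)"] by (simp add: c vector_scalar_commute)
    then have "inverse c *s (c *s (B j *v s j)) = inverse c *s (det (B j) *s s (j + 1))" by simp
    then have "B j *v s j = (det (B j) / c) *s s (j + 1)"
      using c0 by (simp add: vector_smult_assoc divide_inverse mult.commute)
    moreover have "cmod (det (B j)) \<le> d / 8 * opnorm (B j) * cmod c"
    proof -
      have "cmod (det (B j)) \<le> d * d ^ 3 * (opnorm (B j))\<^sup>2"
        using det_le[of j] by (simp add: power_numeral_reduce)
      also have "\<dots> \<le> d * (d / 16) * (opnorm (B j))\<^sup>2"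
      proof -
        have "d ^ 3 \<le> d / 16"
          using mult_left_mono[OF d2_le, of d] d_pos by (simp add: power2_eq_square power3_eq_cube)
        then show ?thesis using d_pos by (intro mult_right_mono mult_left_mono) auto
      qed
      also have "\<dots> = d / 8 * opnorm (B j) * (d / 2 * opnorm (B j))"
        by (simp add: power2_eq_square)
      also have "\<dots> \<le> d / 8 * opnorm (B j) * cmod c"
        using c_ge d_pos norm_pos[of j] by (intro mult_left_mono) auto
      finally show ?thesis .
    qed
    then have "cmod (det (B j) / c) \<le> d / 8 * opnorm (B j)"
      using c0 by (simp add: norm_divide pos_divide_le_eq)
    ultimately show ?thesis by blast
  qed
  show thesis
  proof
    show "norm (u j) = 1" "norm (s j) = 1" for j by (simp_all add: u s_def w)
    show "\<exists>a. B j *v u j = a *s u (j + 1)" for j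
      using wedge_eq_0_collinear[OF u(3) u(1)] by metis
    show "\<exists>a. B j *v s j = a *s s (j + 1)" for j using s by blast
    show "d / 2 * opnorm (B j) \<le> norm (B j *v u j)" for j
      using u(1,2)[of j] by (simp add: cone_def)
    show "norm (B j *v s j) \<le> d / 8 * opnorm (B j)" for j
    proof -
      from s[of j] obtain a where a: "B j *v s j = a *s s (j + 1)" "cmod a \<le> d / 8 * opnorm (B j)"
        by blast
      show ?thesis unfolding a(1) using a(2) by (simp add: s_def w)
    qed
  qed
qed

text \<open>
The two lines cannot come close to each other, because \<open>B j\<close> stretches unit vectors on them by
amounts that differ by at least \<open>d / 2 - d / 8\<close> times \<open>opnorm (B j)\<close>.
\<close>
lemma has_dominated_splitting:
  assumes c: "0 < c" "\<And>j. c \<le> opnorm (B j)"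
  shows "dominated_splitting B"
proof -
  obtain u s where unit: "\<And>j. norm (u j) = 1" "\<And>j. norm (s j) = 1"
    and inv: "\<And>j. \<exists>a. B j *v u j = a *s u (j + 1)" "\<And>j. \<exists>a. B j *v s j = a *s s (j + 1)"
    and u_ge: "\<And>j. d / 2 * opnorm (B j) \<le> norm (B j *v u j)"
    and s_le: "\<And>j. norm (B j *v s j) \<le> d / 8 * opnorm (B j)"
    by (rule splitting_vectors) (rule that)
  define Eu Es where "Eu j = vec.span {u j}" and "Es j = vec.span {s j}" for j
  have lines: "is_line (Eu j)" "is_line (Es j)" for j
    by (simp_all add: Eu_def Es_def is_line_span unit)
  have span_invariant: "(*v) (B j) ` vec.span {x} \<subseteq> vec.span {y}"
    if "\<exists>a. B j *v x = a *s y" for j x y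
    using that by (auto simp: vec.span_singleton vector_scalar_commute vector_smult_assoc)
  have domination: "norm (B j *v x) > 2 * norm (B j *v y)"
    if xy: "x \<in> Eu j" "y \<in> Es j" "norm x = 1" "norm y = 1" for j x y
  proof -
    obtain a b where ab: "x = a *s u j" "y = b *s s j"
      using xy(1,2) unfolding Eu_def Es_def vec.span_singleton by blast
    then have "cmod a = 1" "cmod b = 1" using xy unit by simp_all
    then have "norm (B j *v x) = norm (B j *v u j)" "norm (B j *v y) = norm (B j *v s j)"
      by (simp_all add: ab vector_scalar_commute)
    moreover have "0 < d * opnorm (B j)" using d_pos norm_pos by simp
    ultimately show ?thesis using u_ge[of j] s_le[of j] by simp
  qed
  have separation: "d / 2 \<le> line_dist (Eu j) (Es j)" for j
  proof -
    obtain a e where ae: "u j = a *s s j + e" "cmod a \<le> norm (u j)"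
      "norm e = cmod (wedge (s j) (u j))" by (rule orthogonal_split[OF unit(2)])
    have "B j *v u j = a *s (B j *v s j) + B j *v e"
      unfolding ae(1) matrix_vector_right_distrib vector_scalar_commute ..
    then have "norm (B j *v u j) \<le> cmod a * norm (B j *v s j) + norm (B j *v e)"
      using norm_triangle_ineq[of "a *s (B j *v s j)" "B j *v e"] by simp
    also have "\<dots> \<le> norm (B j *v s j) + opnorm (B j) * norm e"
      using ae(2) unit norm_mult_vec_le by (intro add_mono mult_left_le_one_le) auto
    finally have "d / 2 * opnorm (B j) \<le> d / 8 * opnorm (B j) + opnorm (B j) * norm e"
      using u_ge[of j] s_le[of j] by linarith
    moreover have "0 < d * opnorm (B j)" using d_pos norm_pos by simp
    ultimately have "d * opnorm (B j) / 4 \<le> opnorm (B j) * norm e" by linarith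
    then have "opnorm (B j) * (d / 4) \<le> opnorm (B j) * norm e" by (simp add: mult.commute)
    then have "d / 4 \<le> norm e" using norm_pos[of j] by simp
    moreover have "wedge (u j) (s j) = - wedge (s j) (u j)" by (simp add: wedge_def)
    moreover have "line_dist (Eu j) (Es j) = 2 * cmod (wedge (u j) (s j))"
      unfolding wedge_eq_det
      by (rule line_dist_eq[OF lines]) (auto simp: Eu_def Es_def unit vec.span_base)
    ultimately show ?thesis using ae(3) by simp
  qed
  have inf_dist: "0 < (INF j. line_dist (Eu j) (Es j))"
    using d_pos separation by (intro less_le_trans[OF _ cINF_greatest[of _ "d / 2"]]) auto
  have inf_norm: "0 < (INF j. opnorm (iterate B 1 j))"
    using c by (intro less_le_trans[OF _ cINF_greatest[of _ c]]) auto
  show ?thesis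
    unfolding dominated_splitting_def
  proof (rule exI[of _ Eu], rule exI[of _ Es], intro conjI exI[of _ "1 :: nat"] exI[of _ "2 :: real"] allI ballI impI)
    show "(*v) (B j) ` Eu j \<subseteq> Eu (j + 1)" for j
      unfolding Eu_def by (rule span_invariant[OF inv(1)])
    show "(*v) (B j) ` Es j \<subseteq> Es (j + 1)" for j
      unfolding Es_def by (rule span_invariant[OF inv(2)])
    show "2 * norm (iterate B 1 j *v y) < norm (iterate B 1 j *v x)"
      if "x \<in> Eu j" "y \<in> Es j" "norm x = 1" "norm y = 1" for j x y
      using domination[OF that] by simp
  qed (use lines inf_dist inf_norm in simp_all)
qed

section \<open>The logarithmic estimate\<close>

text \<open>
The constant \<open>6\<close> comes from the lower bound: \<open>- ln (1 - t) \<le> 2 * t\<close> for \<open>0 \<le> t \<le> 1 / 2\<close>, at \<open>t = 3 * d\<^sup>2\<close>.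
\<close>
lemma log_opnorm_iterate:
  "\<bar>ln (opnorm (iterate B (Suc n) j)) - (ln (opnorm (B j)) + (\<Sum>k<n. ln (ratio (j + int k))))\<bar>
    \<le> real n * (6 * d\<^sup>2)"
proof -
  define P where "P = opnorm (B j) * (\<Prod>k<n. ratio (j + int k))"
  define X where "X = opnorm (iterate B (Suc n) j)"
  have P: "P > 0" unfolding P_def using norm_pos ratio_pos by (intro mult_pos_pos prod_pos) auto
  have d2: "3 * d\<^sup>2 \<le> 1 / 2" "0 \<le> 3 * d\<^sup>2" using d2_le by auto
  have lower: "(1 - 3 * d\<^sup>2) ^ n * P \<le> X"
    unfolding P_def X_def by (rule opnorm_iterate_ge)
  have upper: "X \<le> (1 + 3 * d\<^sup>2) ^ n * P"
    unfolding P_def X_def by (rule opnorm_iterate_le)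
  have "0 < (1 - 3 * d\<^sup>2) ^ n * P" using P d2 by (intro mult_pos_pos zero_less_power) auto
  then have X: "X > 0" using lower by linarith
  have "ln X \<le> ln ((1 + 3 * d\<^sup>2) ^ n * P)" using upper X by simp
  also have "\<dots> = real n * ln (1 + 3 * d\<^sup>2) + ln P"
    using P d2 by (subst ln_mult_pos) (auto simp: ln_realpow add_pos_nonneg)
  also have "\<dots> \<le> real n * (6 * d\<^sup>2) + ln P"
    using ln_add_one_self_le_self[OF d2(2)] d2(2) by (intro add_right_mono mult_left_mono) linarith+
  finally have "ln X - ln P \<le> real n * (6 * d\<^sup>2)" by simp
  moreover have "- (real n * (6 * d\<^sup>2)) \<le> ln X - ln P"
  proof -
    have "- (6 * d\<^sup>2) \<le> ln (1 - 3 * d\<^sup>2)"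
    proof -
      have "(3 * d\<^sup>2)\<^sup>2 \<le> 1 / 2 * (3 * d\<^sup>2)"
        using mult_right_mono[OF d2] by (simp add: power2_eq_square)
      then show ?thesis using ln_one_minus_pos_lower_bound[OF d2(2) d2(1)] by simp
    qed
    then have "real n * (- (6 * d\<^sup>2)) + ln P \<le> real n * ln (1 - 3 * d\<^sup>2) + ln P"
      by (intro add_right_mono mult_left_mono) auto
    also have "\<dots> = ln ((1 - 3 * d\<^sup>2) ^ n * P)"
      using P d2 by (subst ln_mult_pos) (auto simp: ln_realpow)
    also have "\<dots> \<le> ln X" using lower X \<open>0 < (1 - 3 * d\<^sup>2) ^ n * P\<close> by simp
    finally show ?thesis by simp
  qed
  moreover have "ln P = ln (opnorm (B j)) + (\<Sum>k<n. ln (ratio (j + int k)))"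
  proof -
    have "ln (\<Prod>k<n. ratio (j + int k)) = (\<Sum>k<n. ln (ratio (j + int k)))"
      using ratio_pos by (intro ln_prod) (auto simp: less_imp_neq[symmetric])
    then show ?thesis
      unfolding P_def using norm_pos ratio_pos by (subst ln_mult_pos) (auto intro!: prod_pos)
  qed
  ultimately show ?thesis unfolding X_def by linarith
qed

text \<open>
In the sum of \<open>ln (ratio (j + k))\<close> over \<open>k \<le> n - 2\<close> the denominators contribute the norms of
\<open>B j, \<dots>, B (j + n - 2)\<close>; the first of them cancels against the initial factor \<open>opnorm (B j)\<close>.
\<close>
lemma log_opnorm_iterate_sums:
  assumes n: "n \<ge> 3"
  shows "\<bar>ln (opnorm (iterate B n j))
          + (\<Sum>k = 1..n - 2. ln (opnorm (B (j + int k))))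
          - (\<Sum>k = 0..n - 2. ln (opnorm (B (j + int k + 1) ** B (j + int k))))\<bar>
        \<le> 6 * real n * d\<^sup>2"
proof -
  define m where "m = n - 2"
  have n_eq: "n = Suc (Suc m)" "n - 2 = m" using n by (auto simp: m_def)
  have prod_pos: "opnorm (B (i + 1) ** B i) > 0" for i
    using ratio_pos[of i] norm_pos[of i] by (simp add: ratio_def zero_less_divide_iff)
  have "(\<Sum>k<Suc m. ln (ratio (j + int k)))
      = (\<Sum>k = 0..m. ln (opnorm (B (j + int k + 1) ** B (j + int k)))) - (\<Sum>k = 0..m. ln (opnorm (B (j + int k))))"
    unfolding ratio_def lessThan_Suc_atMost atLeast0AtMost
    using prod_pos norm_pos by (simp add: ln_div less_imp_neq[symmetric] sum_subtractf del: sum.atMost_Suc)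
  moreover have "(\<Sum>k = 0..m. ln (opnorm (B (j + int k))))
      = ln (opnorm (B j)) + (\<Sum>k = 1..m. ln (opnorm (B (j + int k))))"
    by (simp add: sum.atLeast_Suc_atMost)
  moreover have "real (Suc m) * (6 * d\<^sup>2) \<le> 6 * real n * d\<^sup>2"
    unfolding n_eq by (simp add: algebra_simps)
  ultimately show ?thesis
    using log_opnorm_iterate[of "Suc m" j] unfolding n_eq(2) unfolding n_eq(1) by linarith
qed

end

theorem theorem2:
  "\<exists>\<mu>0 C :: real. \<mu>0 > 1 \<and> C > 0 \<and>
    (\<forall>(\<mu>::real) (c::real) (M::real) (B :: int \<Rightarrow> complex^2^2).
      \<mu> \<ge> \<mu>0 \<longrightarrow> 0 < c \<longrightarrow> c < M \<longrightarrow>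
      (\<forall>j. c < opnorm (B j) \<and> opnorm (B j) < M) \<longrightarrow>
      (\<forall>j. B (j + 1) ** B j \<noteq> 0 \<and>
           sigma2 (B j) / sigma1 (B j) \<le> inverse \<mu> \<and>
           sigma1 (B (j + 1)) * sigma1 (B j) / sigma1 (B (j + 1) ** B j) \<le> \<mu> powr (1 / 4)) \<longrightarrow>
      dominated_splitting B \<and>
      (\<forall>(j::int) (n::nat). n \<ge> 3 \<longrightarrow>
        \<bar>ln (opnorm (iterate B n j))
          + (\<Sum>k = 1..n - 2. ln (opnorm (B (j + int k))))
          - (\<Sum>k = 0..n - 2. ln (opnorm (B (j + int k + 1) ** B (j + int k))))\<bar>
        \<le> C * real n * \<mu> powr (- 1 / 2)))"
  \<comment> \<open>\<open>256 = 4 ^ 4\<close> makes \<open>d = \<mu> powr (- 1 / 4)\<close> at most \<open>1 / 4\<close>.\<close>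
proof (rule exI[of _ "256 :: real"], rule exI[of _ "6 :: real"], intro conjI allI impI)
  fix \<mu> c M :: real and B :: "int \<Rightarrow> complex^2^2"
  assume \<mu>: "256 \<le> \<mu>" and c: "0 < c" and "c < M"
    and bounds: "\<forall>j. c < opnorm (B j) \<and> opnorm (B j) < M"
    and hyp: "\<forall>j. B (j + 1) ** B j \<noteq> 0 \<and>
           sigma2 (B j) / sigma1 (B j) \<le> inverse \<mu> \<and>
           sigma1 (B (j + 1)) * sigma1 (B j) / sigma1 (B (j + 1) ** B j) \<le> \<mu> powr (1 / 4)"
  define d where "d = \<mu> powr (- 1 / 4)"
  have d_pos: "0 < d" using \<mu> by (simp add: d_def)
  have "d ^ 4 = \<mu> powr (- 1)" using \<mu> by (simp add: d_def powr_power)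
  then have d4: "d ^ 4 = inverse \<mu>" using \<mu> by (simp add: powr_minus)
  have d2: "d\<^sup>2 = \<mu> powr (- 1 / 2)"
    using \<mu> by (simp add: d_def powr_power)
  have "d ^ 4 \<le> (1 / 4) ^ 4" unfolding d4 using \<mu> by (simp add: field_simps)
  then have d_le: "d \<le> 1 / 4" by (simp add: power_mono_iff d_pos less_imp_le)
  have norm_pos: "opnorm (B j) > 0" for j using bounds c by (meson less_trans)
  interpret aligned_products B d
  proof
    fix j
    show "cmod (det (B j)) \<le> d ^ 4 * (opnorm (B j))\<^sup>2"
      using hyp[rule_format, of j] norm_pos[of j]
      by (simp add: d4 sigma1_def sigma2_def power2_eq_square pos_divide_le_eq)
    have "opnorm (B (j + 1) ** B j) \<noteq> 0"
    proof
      assume "opnorm (B (j + 1) ** B j) = 0"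
      then have "(B (j + 1) ** B j) *v x = 0" for x
        using norm_mult_vec_le[of "B (j + 1) ** B j" x] by simp
      then have "B (j + 1) ** B j = 0" by (simp add: matrix_eq)
      then show False using hyp by blast
    qed
    then have "opnorm (B (j + 1) ** B j) > 0"
      using opnorm_nonneg[of "B (j + 1) ** B j"] by linarith
    then have "opnorm (B (j + 1)) * opnorm (B j) \<le> \<mu> powr (1 / 4) * opnorm (B (j + 1) ** B j)"
      using hyp[rule_format, of j] by (simp add: sigma1_def pos_divide_le_eq)
    then have "d * (opnorm (B (j + 1)) * opnorm (B j))
        \<le> d * (\<mu> powr (1 / 4) * opnorm (B (j + 1) ** B j))"
      using d_pos by (intro mult_left_mono) auto
    also have "\<dots> = opnorm (B (j + 1) ** B j)"
      using \<mu> by (simp add: d_def powr_minus)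
    finally show "d * (opnorm (B (j + 1)) * opnorm (B j)) \<le> opnorm (B (j + 1) ** B j)" .
  qed (use d_pos d_le norm_pos in auto)
  show "dominated_splitting B"
    using bounds by (intro has_dominated_splitting[OF c]) (auto intro: less_imp_le)
  show "\<bar>ln (opnorm (iterate B n j))
          + (\<Sum>k = 1..n - 2. ln (opnorm (B (j + int k))))
          - (\<Sum>k = 0..n - 2. ln (opnorm (B (j + int k + 1) ** B (j + int k))))\<bar>
        \<le> 6 * real n * \<mu> powr (- 1 / 2)" if "3 \<le> n" for j n
    using log_opnorm_iterate_sums[OF that] by (simp only: d2)
qed simp_all

end
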